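(* Let $D$ be a multipartite tournament with the sink elimination index $\zeta(D)\ge 1$, the sink sequence $(W_0,\ldots,W_{\zeta(D)})$, and the digraph sequence $(D_0,\ldots,D_{\zeta(D)})$ associated with the sink sequence. For a vertex $u\in V(D_{\zeta(D)})$, suppose that there exists a $(u,w)$-directed walk of length $\ell$ for some vertex $w\in\bigcup_{i=0}^{\zeta(D)-1}W_i$ such that its sequence contains both a directed cycle of length $3$ and a directed hole of length $4$. Then there exists a positive integer $N$ such that for each integer $m\ge N$, there is a $(u,w)$-directed walk of length $\ell+m$.
   Context: All digraphs are finite, and the underlying graph of each digraph is simple (no loops, no multiple arcs, no directed cycles of length $2$). A multipartite tournament is an orientation of a complete $k$-partite graph (with $k$ nonempty partite sets) for some integer $k\ge 2$. A $(u,w)$-directed walk is a directed walk from $u$ to $w$. A directed hole in $D$ is a directed cycle of length at least $4$ in $D$ that is an induced subdigraph of $D$. The sequence of a directed walk is its sequence of vertices $x_0,x_1,\ldots,x_\ell$; it contains a directed cycle $c_0\to c_1\to\cdots\to c_{r-1}\to c_0$ if, for a suitable choice of starting vertex $c_0$ of the cycle, the sequence $c_0,c_1,\ldots,c_{r-1},c_0$ appears as consecutive terms of it. Sink sequence: a sink is a vertex of outdegree zero. Let $D_0=D$, and for each $i$ let $W_i$ be the set of sinks of $D_i$; if $W_i=V(D_i)$ or $W_i=\emptyset$, stop and put $\zeta(D)=i$; otherwise let $D_{i+1}=D_i-W_i$ (delete the vertices in $W_i$) and continue. The number $\zeta(D)$ is the sink elimination index of $D$, $(W_0,\ldots,W_{\zeta(D)})$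 is the sink sequence of $D$, and $(D_0,\ldots,D_{\zeta(D)})$ is the digraph sequence associated with the sink sequence. *)

theory Defs
  imports Graph_Theory.Graph_Theory "HOL-Library.Disjoint_Sets" "HOL-Library.Sublist"
begin

text \<open>
  As in the library's \<open>complete_bipartite_digraph\<close>, an undirected simple graph is a symmetric
  digraph; \<open>P\<close> is the set of the \<open>k\<close> partite sets, which are nonempty by \<open>partition_on\<close>.
\<close>

definition complete_multipartite_digraph :: "nat \<Rightarrow> ('a, 'b) pre_digraph \<Rightarrow> bool" where
  "complete_multipartite_digraph k G \<longleftrightarrow> graph G \<and>
     (\<exists>P. partition_on (verts G) P \<and> finite P \<and> card P = k \<and>
        arcs_ends G = {(u, v). \<exists>A\<in>P. \<exists>B\<in>P. A \<noteq> B \<and> u \<in> A \<and> v \<in> B})"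

text \<open>
  The library's \<open>digraph\<close> is finite without loops and parallel arcs; \<open>asym\<close> excludes directed
  cycles of length 2. The underlying graph is \<open>mk_symmetric D\<close>.
\<close>

definition multipartite_tournament :: "('a, 'b) pre_digraph \<Rightarrow> bool" where
  "multipartite_tournament D \<longleftrightarrow> digraph D \<and> asym (arcs_ends D) \<and>
     (\<exists>k\<ge>2. complete_multipartite_digraph k (with_proj (mk_symmetric D)))"

definition sinks :: "('a, 'b) pre_digraph \<Rightarrow> 'a set" where
  "sinks D = {v \<in> verts D. out_degree D v = 0}"

text \<open>
  \<open>digraph_seq D i\<close> and \<open>sink_seq D i\<close> are \<open>D\<^sub>i\<close> and \<open>W\<^sub>i\<close>. They are total in \<open>i\<close>; only the values
  for \<open>i \<le> sink_elim_index D\<close> are meaningful.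
\<close>

primrec digraph_seq :: "('a, 'b) pre_digraph \<Rightarrow> nat \<Rightarrow> ('a, 'b) pre_digraph" where
  "digraph_seq D 0 = D"
| "digraph_seq D (Suc i) =
     digraph_seq D i \<restriction> (verts (digraph_seq D i) - sinks (digraph_seq D i))"

definition sink_seq :: "('a, 'b) pre_digraph \<Rightarrow> nat \<Rightarrow> 'a set" where
  "sink_seq D i = sinks (digraph_seq D i)"

definition sink_elim_index :: "('a, 'b) pre_digraph \<Rightarrow> nat" where
  "sink_elim_index D =
     (LEAST i. sink_seq D i = verts (digraph_seq D i) \<or> sink_seq D i = {})"

text \<open>The elimination stops, so the \<open>LEAST\<close> above is attained.\<close>

lemma sink_elim_stops:
  assumes "finite (verts D)"
  shows "\<exists>i. sink_seq D i = verts (digraph_seq D i) \<or> sink_seq D i = {}"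
proof (rule ccontr)
  assume "\<not> ?thesis"
  then have ne: "sink_seq D i \<noteq> {}" for i by blast
  have "finite (verts (digraph_seq D i)) \<and> card (verts (digraph_seq D i)) + i \<le> card (verts D)" for i
  proof (induction i)
    case 0
    show ?case using assms by simp
  next
    case (Suc i)
    have "verts (digraph_seq D (Suc i)) \<subset> verts (digraph_seq D i)"
      using ne[of i] by (auto simp: sink_seq_def sinks_def)
    moreover from this have "card (verts (digraph_seq D (Suc i))) < card (verts (digraph_seq D i))"
      using Suc.IH psubset_card_mono by blast
    ultimately show ?case using Suc.IH by (auto intro: finite_subset)
  qed
  from this[of "Suc (card (verts D))"] show False by simp
qed

text \<open>
  A directed cycle is given by its list of arcs, starting at an arbitrary one of its vertices.
  A cycle is induced if the subdigraph formed by its vertices and arcs is.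
\<close>

definition directed_hole :: "('a, 'b) pre_digraph \<Rightarrow> 'b awalk \<Rightarrow> bool" where
  "directed_hole D c \<longleftrightarrow> pre_digraph.cycle D c \<and> length c \<ge> 4 \<and>
     induced_subgraph
       \<lparr> verts = tail D ` set c, arcs = set c, tail = tail D, head = head D \<rparr> D"

text \<open>
  For a cycle \<open>c\<close> starting at \<open>c\<^sub>0\<close>, \<open>cycle_seq D c\<close> is the sequence
  \<open>c\<^sub>0, c\<^sub>1, \<dots>, c\<^sub>r\<^sub>-\<^sub>1, c\<^sub>0\<close>, with \<open>c\<^sub>0\<close> repeated at the end.
\<close>

definition cycle_seq :: "('a, 'b) pre_digraph \<Rightarrow> 'b awalk \<Rightarrow> 'a list" where
  "cycle_seq D c = pre_digraph.awalk_verts D (tail D (hd c)) c"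

end

theory Submission
  imports Defs
begin

text \<open>
  Traversing the 3-cycle \<open>i\<close> and the 4-cycle \<open>j\<close> additional times lengthens the walk by
  \<open>3 * i + 4 * j\<close>, and every integer from 6 on has this form.
\<close>

context wf_digraph
begin

text \<open>Cut the walk at an occurrence of \<open>v\<close> and splice \<open>c\<close> in there.
  Nothing of the old walk is lost, and the inclusion of vertex sets records this, so that further
  closed walks can be inserted later at any vertex of the original walk.\<close>

lemma awalk_insert_closed:
  assumes p: "awalk u p w" and v: "v \<in> set (awalk_verts u p)" and c: "awalk v c v"
  shows "\<exists>q. awalk u q w \<and> length q = length p + length c \<and>
           set (awalk_verts u p) \<subseteq> set (awalk_verts u q)"
proof -
  obtain r s where rs: "p = r @ s" "awalk u r v" "awalk v s w"
    using awalk_decomp[OF p v] by blast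
  have cs: "awalk v (c @ s) w" using c rs(3) by (rule awalk_appendI)
  have q: "awalk u (r @ c @ s) w" using rs(2) cs by (rule awalk_appendI)
  have "set (awalk_verts u p) \<subseteq> set (awalk_verts u (r @ c @ s))"
    using p q rs cs c by (auto simp: set_awalk_verts_append)
  with q rs(1) show ?thesis by (intro exI[of _ "r @ c @ s"]) simp
qed

lemma awalk_insert_closed_iter:
  assumes p: "awalk u p w" and v: "v \<in> set (awalk_verts u p)" and c: "awalk v c v"
  shows "\<exists>q. awalk u q w \<and> length q = length p + n * length c \<and>
           set (awalk_verts u p) \<subseteq> set (awalk_verts u q)"
proof (induction n)
  case 0
  then show ?case using p by auto
next
  case (Suc n)
  then obtain q where q: "awalk u q w" "length q = length p + n * length c"
    "set (awalk_verts u p) \<subseteq> set (awalk_verts u q)" by blast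
  with v have "v \<in> set (awalk_verts u q)" by blast
  from awalk_insert_closed[OF q(1) this c] q(2,3) show ?case by fastforce
qed

text \<open>The sequence of a cycle begins with its base vertex, so a walk whose sequence contains
  it visits a vertex at which the cycle can be inserted as a closed walk.\<close>

lemma cycle_closed_walk:
  assumes "cycle c" and "sublist (cycle_seq G c) vs"
  obtains v where "v \<in> set vs" and "awalk v c v"
proof -
  obtain v where v: "awalk v c v" "c \<noteq> []"
    using assms(1) by (auto simp: cycle_def)
  \<comment> \<open>The base vertex given by \<open>cycle\<close> is existential; as
    \<open>c\<close> is nonempty, its first arc determines it, in agreement with the start chosen in
    \<open>cycle_seq\<close>.\<close>
  then have "v = tail G (hd c)"
    by (cases c) (auto simp: awalk_Cons_iff)
  then have "v \<in> set (cycle_seq G c)"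
    using v by (cases c) (auto simp: cycle_seq_def)
  then have "v \<in> set vs" using assms(2) set_mono_sublist by blast
  then show ?thesis using v(1) that by blast
qed

end

text \<open>Holds since 6 = 3 + 3, 7 = 3 + 4 and 8 = 4 + 4, and further threes reach every larger
  number. The bound is sharp, as 5 has no such form.\<close>

lemma nat_eq_3_4_combination:
  fixes m :: nat
  assumes "m \<ge> 6"
  shows "\<exists>i j. m = i * 3 + j * 4"
  using assms by presburger

theorem lemma3p6:
  fixes D :: "('a, 'b) pre_digraph" and u w :: 'a and l :: nat
  assumes "multipartite_tournament D"
    and "sink_elim_index D \<ge> 1"
    and "u \<in> verts (digraph_seq D (sink_elim_index D))"
    and "w \<in> (\<Union>i<sink_elim_index D. sink_seq D i)"
    and "\<exists>p. pre_digraph.awalk D u p w \<and> length p = l \<and>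
           (\<exists>c. pre_digraph.cycle D c \<and> length c = 3 \<and>
                sublist (cycle_seq D c) (pre_digraph.awalk_verts D u p)) \<and>
           (\<exists>h. directed_hole D h \<and> length h = 4 \<and>
                sublist (cycle_seq D h) (pre_digraph.awalk_verts D u p))"
  shows "\<exists>N::nat. N > 0 \<and> (\<forall>m\<ge>N. \<exists>q. pre_digraph.awalk D u q w \<and> length q = l + m)"
proof -
  interpret digraph D using assms(1) by (simp add: multipartite_tournament_def)
  obtain p c h where p: "awalk u p w" "length p = l"
    and c: "cycle c" "length c = 3" "sublist (cycle_seq D c) (awalk_verts u p)"
    and h: "cycle h" "length h = 4" "sublist (cycle_seq D h) (awalk_verts u p)"
    using assms(5) unfolding directed_hole_def by blast
  obtain a where a: "a \<in> set (awalk_verts u p)" "awalk a c a"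
    using cycle_closed_walk[OF c(1,3)] .
  obtain b where b: "b \<in> set (awalk_verts u p)" "awalk b h b"
    using cycle_closed_walk[OF h(1,3)] .
  have "\<exists>q. awalk u q w \<and> length q = l + m" if m6: "m \<ge> 6" for m
  proof -
    obtain i j where m: "m = i * 3 + j * 4" using nat_eq_3_4_combination[OF m6] by blast
    obtain q where q: "awalk u q w" "length q = l + i * 3"
      "set (awalk_verts u p) \<subseteq> set (awalk_verts u q)"
      using awalk_insert_closed_iter[OF p(1) a, of i] p(2) c(2) by auto
    \<comment> \<open>The 3-cycle has been inserted at \<open>a\<close>, but \<open>b\<close> is
      still visited, so the 4-cycle can be inserted into the longer walk.\<close>
    then have "b \<in> set (awalk_verts u q)" using b(1) by blast
    from awalk_insert_closed_iter[OF q(1) this b(2), of j] q(2) h(2) m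
    show ?thesis by auto
  qed
  \<comment> \<open>The witness 6 is the threshold 3 * 4 - 3 - 4 + 1 for combinations of the coprime
    lengths 3 and 4.\<close>
  then show ?thesis by (intro exI[of _ 6]) simp
qed

end
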